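(* Consider the Sylvester equation $AX+XB=C$ with $(\mathcal T_p^{(H)},k)$-HODLR matrices $A,B\in\mathbb C^{n\times n}$ and a $(\mathcal T,k_C)$-HALR matrix $C\in\mathbb C^{n\times n}$, with a quad-tree cluster $\mathcal T$ that is compatible with $\mathcal T_p^{(H)}$ and has depth $p_C\le p$. Suppose that $p\sim\log(n)$, and let $n_{\min}$ denote the size of the minimal blocks in $A,B$. If Assumption 1 (stated in the context) holds, then the cost of the divide-and-conquer algorithm D&C_Sylv (described in the context) for computing the solution $X$ is $\mathcal O\big(S\,(n_{\min}+k^2\log^2 n)\big)$, where $S$ is the storage required for $C$.
   Context: **Quad-tree clusters.** For integers $0<a\le b$ write $[a,b]=\{a,a+1,\dots,b\}$. For intervals, $[a,b]<[a',b']$ means $b<a'$. A quad-tree cluster $\mathcal T$ for $[1,m]\times[1,n]$ is a tree with root $[1,m]\times[1,n]$ in which every node is a product of intervals $I=I_r\times I_c=[m_1,m_2]\times[n_1,n_2]\subseteq[1,m]\times[1,n]$. Every non-leaf node $I_r\times I_c$ has four children $I_{ij}=I_{r_i}\times I_{c_j}$, $i,j\in\{1,2\}$, with $I_r=I_{r_1}\sqcup I_{r_2}$, $I_c=I_{c_1}\sqcup I_{c_2}$, $I_{r_1}<I_{r_2}$, $I_{c_1}<I_{c_2}$. Every leaf is labeled either "dense" or "low-rank". A subtree is regarded as a quad-tree cluster after translating its index intervals so that both the row and the column interval of its root start at $1$. The depth is the number of levels, so a tree consisting only of its root has depth $1$. **HALR matrices.** $A\in\mathbb C^{m\times n}$ is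 $(\mathcal T,k)$-HALR if for every leaf $I_r\times I_c$ of $\mathcal T$ labeled low-rank the submatrix $A(I_r,I_c)$ has rank at most $k$. It is stored through $\mathcal T$: dense leaf blocks of size $a\times b$ are stored explicitly ($ab$ numbers), and a low-rank leaf block of size $a\times b$ and rank $r$ is stored by factors $U\in\mathbb C^{a\times r}$, $V\in\mathbb C^{b\times r}$ with block equal to $UV^T$ ($(a+b)r$ numbers). The storage is the total over all leaves. **HODLR.** A quad-tree cluster $\mathcal T_p^{(H)}$ of depth $p$ is a HODLR cluster if either $p=1$ and it consists only of the root, labeled dense, or the children of the root satisfy: $I_{12},I_{21}$ are leaves labeled low-rank, and the subtrees at $I_{11},I_{22}$ are HODLR clusters of depth $p-1$. A matrix is $(\mathcal T_p^{(H)},k)$-HODLR if it is $(\mathcal T_p^{(H)},k)$-HALR; the smallest such $k$ is its HODLR rank. The minimal blocks are the dense diagonal blocks at the leaves. **Compatibility.** The transposed cluster $\mathcal T^T$ of a quad-tree cluster $\mathcal T$ for $[1,m]\times[1,n]$ is the quad-tree cluster for $[1,n]\times[1,m]$ obtained by replacing each node $I_r\times I_c$ with $I_c\times I_r$ and swapping the subtrees at $I_{12}$ and $I_{21}$ for every non-leaf node. Let $\mathcal T_1,\mathcal T_2$ be quad-tree clusters for $[1,m_1]\times[1,n_1]$ and $[1,m_2]\times[1,n_2]$, with roots $I_1$ and $I_2$. They are row-compatible if one of the following holds: (i) $\mathcal T_1$ or $\mathcal T_2$ only contains the root, and $m_1=m_2$; (ii) for every $i,j=1,2$ the subtrees at $(I_1)_{ij}$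 and $(I_2)_{ij}$ are row-compatible. They are column-compatible if $\mathcal T_1^T$ and $\mathcal T_2^T$ are row-compatible, and compatible if they are both row- and column-compatible. **Subroutines.** LowRankRHS_Sylv solves $AX+XB=C$ when $C$ is given by a low-rank factorization, returning $X$ in low-rank factorized form. *Assumption 1:* the computational cost of LowRankRHS_Sylv for $AX+XB=C$ is $\mathcal O(k_Ck\,n\log n+k^2n\log^2 n)$, where $n$ is the size of $A,B$, $k$ is their HODLR rank, and $k_C$ is the rank of $C$; the rank of $X$ is $\mathcal O(k_C)$. DenseRHS_Sylv$(A,B,C)$, for HODLR $A,B$ and dense $C$: if the clusters of $A$ and $B$ both have depth $1$, use a standard dense solver (cubic cost in the size). Otherwise partition $C$ into $2\times2$ dense blocks according to the partitioning of $A,B$, recursively compute $\tilde X_{ij}=$ DenseRHS_Sylv$(A_{ii},B_{jj},C_{ij})$ for $i,j=1,2$, form in low-rank factorized form $$\tilde C=-\begin{bmatrix}0&A_{12}\\ A_{21}&0\end{bmatrix}\tilde X-\tilde X\begin{bmatrix}0&B_{12}\\ B_{21}&0\end{bmatrix},\qquad \tilde X=\begin{bmatrix}\tilde X_{11}&\tilde X_{12}\\ \tilde X_{21}&\tilde X_{22}\end{bmatrix},$$ compute $\delta X=$ LowRankRHS_Sylv$(A,B,\tilde C)$ and return $\tilde X+\delta X$. **Algorithm D&C_Sylv$(A,B,C)$.** If the cluster of $C$ has depth $1$: return LowRankRHS_Sylv$(A,B,C)$ if $C$ is labeled low-rank and DenseRHS_Sylv$(A,B,C)$ if it is labeled dense.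 Otherwise partition $A,B,C$ into $2\times 2$ blocks according to the four children of the root of the cluster of $C$, compute $\tilde X_{ij}=$ D&C_Sylv$(A_{ii},B_{jj},C_{ij})$ for $i,j=1,2$, form the matrix $\tilde C$ by the formula above in low-rank factorized form, compute $\delta X=$ LowRankRHS_Sylv$(A,B,\tilde C)$, and return $\tilde X+\delta X$ in HALR format with cluster $\mathcal T$.
   Formalization: A zero low-rank block of C is counted as stored with one zero column, so S includes a+b for it (with literal rank-0 storage the claim fails, e.g. for C = 0, where S = 0), and the HODLR rank bound k is taken to be at least 1. *)

theory Defs
  imports Complex_Main "Jordan_Normal_Form.DL_Rank"
begin

section \<open>Quad-tree clusters\<close>

text \<open>The pair \<open>(a, b)\<close> stands for the interval \<open>{a, a+1, ..., b}\<close>.\<close>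
type_synonym interval = "nat \<times> nat"

definition valid_interval :: "interval \<Rightarrow> bool" where
  "valid_interval I \<longleftrightarrow> 0 < fst I \<and> fst I \<le> snd I"

definition ilen :: "interval \<Rightarrow> nat" where
  "ilen I = Suc (snd I) - fst I"

text \<open>For valid intervals: \<open>I\<close> is the disjoint union of \<open>I1\<close> and \<open>I2\<close>, and \<open>I1 < I2\<close>.\<close>
definition splits :: "interval \<Rightarrow> interval \<Rightarrow> interval \<Rightarrow> bool" where
  "splits I I1 I2 \<longleftrightarrow> fst I1 = fst I \<and> fst I2 = Suc (snd I1) \<and> snd I2 = snd I"

datatype label = Dense | LowRank

text \<open>The subtrees of a \<open>Node\<close> are listed in the order 11, 12, 21, 22.\<close>
datatype cluster =
    Leaf interval interval label
  | Node interval interval cluster cluster cluster cluster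

fun row_ivl :: "cluster \<Rightarrow> interval" where
  "row_ivl (Leaf I J l) = I"
| "row_ivl (Node I J T11 T12 T21 T22) = I"

fun col_ivl :: "cluster \<Rightarrow> interval" where
  "col_ivl (Leaf I J l) = J"
| "col_ivl (Node I J T11 T12 T21 T22) = J"

text \<open>The root of a \<open>quad_tree\<close> may lie anywhere, so subtrees need not be translated; all notions
  below except \<open>cluster_for\<close> are invariant under translation.\<close>
fun quad_tree :: "cluster \<Rightarrow> bool" where
  "quad_tree (Leaf I J l) \<longleftrightarrow> valid_interval I \<and> valid_interval J"
| "quad_tree (Node I J T11 T12 T21 T22) \<longleftrightarrow>
     valid_interval I \<and> valid_interval J \<and>
     (\<exists>I1 I2 J1 J2. splits I I1 I2 \<and> splits J J1 J2 \<and>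
        row_ivl T11 = I1 \<and> col_ivl T11 = J1 \<and> row_ivl T12 = I1 \<and> col_ivl T12 = J2 \<and>
        row_ivl T21 = I2 \<and> col_ivl T21 = J1 \<and> row_ivl T22 = I2 \<and> col_ivl T22 = J2) \<and>
     quad_tree T11 \<and> quad_tree T12 \<and> quad_tree T21 \<and> quad_tree T22"

definition cluster_for :: "nat \<Rightarrow> nat \<Rightarrow> cluster \<Rightarrow> bool" where
  "cluster_for m n T \<longleftrightarrow> quad_tree T \<and> row_ivl T = (1, m) \<and> col_ivl T = (1, n)"

fun depth :: "cluster \<Rightarrow> nat" where
  "depth (Leaf I J l) = 1"
| "depth (Node I J T11 T12 T21 T22) =
     Suc (max (max (depth T11) (depth T12)) (max (depth T21) (depth T22)))"

fun hodlr_cluster :: "nat \<Rightarrow> cluster \<Rightarrow> bool" where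
  "hodlr_cluster p (Leaf I J l) \<longleftrightarrow> p = 1 \<and> l = Dense"
| "hodlr_cluster p (Node I J T11 T12 T21 T22) \<longleftrightarrow> 1 < p \<and>
     (\<exists>I12 J12. T12 = Leaf I12 J12 LowRank) \<and> (\<exists>I21 J21. T21 = Leaf I21 J21 LowRank) \<and>
     hodlr_cluster (p - 1) T11 \<and> hodlr_cluster (p - 1) T22"

text \<open>Sizes (rows, columns) of the dense leaf blocks.\<close>
fun dense_sizes :: "cluster \<Rightarrow> (nat \<times> nat) set" where
  "dense_sizes (Leaf I J l) = (if l = Dense then {(ilen I, ilen J)} else {})"
| "dense_sizes (Node I J T11 T12 T21 T22) =
     dense_sizes T11 \<union> dense_sizes T12 \<union> dense_sizes T21 \<union> dense_sizes T22"

fun transpose_cluster :: "cluster \<Rightarrow> cluster" where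
  "transpose_cluster (Leaf I J l) = Leaf J I l"
| "transpose_cluster (Node I J T11 T12 T21 T22) =
     Node J I (transpose_cluster T11) (transpose_cluster T21)
              (transpose_cluster T12) (transpose_cluster T22)"

text \<open>The second equation applies only if at least one of the two trees is a leaf.\<close>
fun row_compatible :: "cluster \<Rightarrow> cluster \<Rightarrow> bool" where
  "row_compatible (Node I J T11 T12 T21 T22) (Node I' J' T11' T12' T21' T22') \<longleftrightarrow>
     row_compatible T11 T11' \<and> row_compatible T12 T12' \<and>
     row_compatible T21 T21' \<and> row_compatible T22 T22'"
| "row_compatible T T' \<longleftrightarrow> ilen (row_ivl T) = ilen (row_ivl T')"

definition col_compatible :: "cluster \<Rightarrow> cluster \<Rightarrow> bool" where
  "col_compatible T T' \<longleftrightarrow> row_compatible (transpose_cluster T) (transpose_cluster T')"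

definition compatible :: "cluster \<Rightarrow> cluster \<Rightarrow> bool" where
  "compatible T T' \<longleftrightarrow> row_compatible T T' \<and> col_compatible T T'"


section \<open>HALR and HODLR matrices and their storage\<close>

text \<open>Intervals are 1-based, matrix indices are 0-based.\<close>
definition block :: "complex mat \<Rightarrow> interval \<Rightarrow> interval \<Rightarrow> complex mat" where
  "block M I J = mat (ilen I) (ilen J) (\<lambda>(i, j). M $$ (fst I - 1 + i, fst J - 1 + j))"

abbreviation mrank :: "complex mat \<Rightarrow> nat" where
  "mrank M \<equiv> vec_space.rank (dim_row M) M"

fun halr :: "cluster \<Rightarrow> nat \<Rightarrow> complex mat \<Rightarrow> bool" where
  "halr (Leaf I J l) k M \<longleftrightarrow> (l = LowRank \<longrightarrow> mrank (block M I J) \<le> k)"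
| "halr (Node I J T11 T12 T21 T22) k M \<longleftrightarrow>
     halr T11 k M \<and> halr T12 k M \<and> halr T21 k M \<and> halr T22 k M"

text \<open>Data stored along a cluster; the factors \<open>(U, V)\<close> stand for the matrix \<open>U * V\<^sup>T\<close>.\<close>
type_synonym factors = "complex mat \<times> complex mat"

datatype hmat =
    DenseBlk "complex mat"
  | LowRankBlk factors
  | Blocks hmat hmat hmat hmat

definition fmat :: "factors \<Rightarrow> complex mat" where
  "fmat F = fst F * transpose_mat (snd F)"

definition width :: "factors \<Rightarrow> nat" where
  "width F = dim_col (fst F)"

definition factors_shape :: "nat \<Rightarrow> nat \<Rightarrow> factors \<Rightarrow> bool" where
  "factors_shape a b F \<longleftrightarrow>
     fst F \<in> carrier_mat a (width F) \<and> snd F \<in> carrier_mat b (width F)"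

fun mat_of :: "hmat \<Rightarrow> complex mat" where
  "mat_of (DenseBlk D) = D"
| "mat_of (LowRankBlk F) = fmat F"
| "mat_of (Blocks H11 H12 H21 H22) =
     four_block_mat (mat_of H11) (mat_of H12) (mat_of H21) (mat_of H22)"

abbreviation nrows :: "hmat \<Rightarrow> nat" where "nrows H \<equiv> dim_row (mat_of H)"
abbreviation ncols :: "hmat \<Rightarrow> nat" where "ncols H \<equiv> dim_col (mat_of H)"

text \<open>\<open>stores T M H\<close>: \<open>H\<close> is the representation through \<open>T\<close> of the block of \<open>M\<close> at the root of
  \<open>T\<close>. Factorizations of a block of rank \<open>r\<close> have \<open>r\<close> columns, except that a zero block is stored
  with one (zero) column. Without this convention the zero matrix would need no storage at all,
  while a bound \<open>O(k\<^sub>C k n log n + k\<^sup>2 n log\<^sup>2 n)\<close> stays positive for \<open>k\<^sub>C = 0\<close>.\<close>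
fun stores :: "cluster \<Rightarrow> complex mat \<Rightarrow> hmat \<Rightarrow> bool" where
  "stores (Leaf I J Dense) M (DenseBlk D) \<longleftrightarrow> D = block M I J"
| "stores (Leaf I J LowRank) M (LowRankBlk F) \<longleftrightarrow>
     factors_shape (ilen I) (ilen J) F \<and> width F = max 1 (mrank (block M I J)) \<and>
     fmat F = block M I J"
| "stores (Node I J T11 T12 T21 T22) M (Blocks H11 H12 H21 H22) \<longleftrightarrow>
     stores T11 M H11 \<and> stores T12 M H12 \<and> stores T21 M H21 \<and> stores T22 M H22"
| "stores _ _ _ \<longleftrightarrow> False"

text \<open>The number of stored matrix entries.\<close>
fun storage :: "hmat \<Rightarrow> nat" where
  "storage (DenseBlk D) = dim_row D * dim_col D"
| "storage (LowRankBlk F) = (dim_row (fst F) + dim_row (snd F)) * width F"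
| "storage (Blocks H11 H12 H21 H22) = storage H11 + storage H12 + storage H21 + storage H22"

text \<open>\<open>H\<close> represents a square matrix that is HODLR of rank at most \<open>k\<close> for some HODLR cluster.\<close>
definition stored_hodlr :: "nat \<Rightarrow> hmat \<Rightarrow> bool" where
  "stored_hodlr k H \<longleftrightarrow> nrows H = ncols H \<and>
     (\<exists>p T M. quad_tree T \<and> hodlr_cluster p T \<and> halr T k M \<and> stores T M H)"


section \<open>The subroutines\<close>

definition solves_sylvester ::
    "complex mat \<Rightarrow> complex mat \<Rightarrow> complex mat \<Rightarrow> complex mat \<Rightarrow> bool" where
  "solves_sylvester A B C X \<longleftrightarrow> X \<in> carrier_mat (dim_row A) (dim_row B) \<and> A * X + X * B = C"

text \<open>\<open>LR A B C X t\<close>: the call of LowRankRHS\_Sylv on \<open>A\<close>, \<open>B\<close>, \<open>C\<close> returns \<open>X\<close> after \<open>t\<close>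
  arithmetic operations. This is a relation, not a function: the exact solution for a low-rank
  right-hand side need not have low rank, so the cost assumption below could not be imposed
  together with exactness on a solver that accepts every input.\<close>
type_synonym lr_solver = "hmat \<Rightarrow> hmat \<Rightarrow> factors \<Rightarrow> factors \<Rightarrow> nat \<Rightarrow> bool"

definition low_rank_rhs_solver :: "lr_solver \<Rightarrow> bool" where
  "low_rank_rhs_solver LR \<longleftrightarrow>
     (\<forall>A B C X t. LR A B C X t \<and> nrows A = ncols A \<and> nrows B = ncols B \<and>
        factors_shape (nrows A) (nrows B) C \<longrightarrow>
        factors_shape (nrows A) (nrows B) X \<and>
        solves_sylvester (mat_of A) (mat_of B) (fmat C) (fmat X))"

text \<open>Logarithm bounded below by 1, so that bounds on a cost do not degenerate to 0 at size 1.\<close>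
definition lg :: "nat \<Rightarrow> real" where
  "lg n = max 1 (log 2 (real n))"

text \<open>Assumption 1. In the recursion the two coefficients may differ in size, and \<open>n\<close> is the larger
  size. The ranks of \<open>C\<close> and \<open>X\<close> are those of their factorizations, i.e. the numbers of columns,
  and \<open>k \<ge> 1\<close> is any common bound for the HODLR ranks of \<open>A\<close> and \<open>B\<close>.\<close>
definition assumption1 :: "lr_solver \<Rightarrow> bool" where
  "assumption1 LR \<longleftrightarrow>
     (\<exists>K::real. \<forall>k A B C X t. 1 \<le> k \<and> stored_hodlr k A \<and> stored_hodlr k B \<and>
        factors_shape (nrows A) (nrows B) C \<and> LR A B C X t \<longrightarrow>
        (let n = max (nrows A) (nrows B) in
          real t \<le> K * (real (width C) * real k * real n * lg n
                          + (real k)\<^sup>2 * real n * (lg n)\<^sup>2)) \<and>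
        real (width X) \<le> K * real (width C))"

type_synonym dense_solver =
  "complex mat \<Rightarrow> complex mat \<Rightarrow> complex mat \<Rightarrow> complex mat \<Rightarrow> nat \<Rightarrow> bool"

definition cubic_dense_solver :: "dense_solver \<Rightarrow> bool" where
  "cubic_dense_solver DS \<longleftrightarrow>
     (\<forall>A B C X t. DS A B C X t \<and> square_mat A \<and> square_mat B \<and>
        C \<in> carrier_mat (dim_row A) (dim_row B) \<longrightarrow> solves_sylvester A B C X) \<and>
     (\<exists>K::real. \<forall>A B C X t. DS A B C X t \<and> square_mat A \<and> square_mat B \<and>
        C \<in> carrier_mat (dim_row A) (dim_row B) \<longrightarrow>
        real t \<le> K * real (max (dim_row A) (dim_row B)) ^ 3)"


section \<open>Arithmetic with stored matrices\<close>

text \<open>Number of arithmetic operations for multiplying a stored matrix, respectively its transpose,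
  by a dense matrix with \<open>w\<close> columns. The last summand in the case of a block matrix accounts for
  the addition of the partial products.\<close>
fun mult_cost :: "hmat \<Rightarrow> nat \<Rightarrow> nat" where
  "mult_cost (DenseBlk D) w = 2 * dim_row D * dim_col D * w"
| "mult_cost (LowRankBlk F) w = 2 * (dim_row (fst F) + dim_row (snd F)) * width F * w"
| "mult_cost (Blocks H11 H12 H21 H22) w =
     mult_cost H11 w + mult_cost H12 w + mult_cost H21 w + mult_cost H22 w
     + nrows (Blocks H11 H12 H21 H22) * w"

fun tmult_cost :: "hmat \<Rightarrow> nat \<Rightarrow> nat" where
  "tmult_cost (DenseBlk D) w = 2 * dim_row D * dim_col D * w"
| "tmult_cost (LowRankBlk F) w = 2 * (dim_row (fst F) + dim_row (snd F)) * width F * w"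
| "tmult_cost (Blocks H11 H12 H21 H22) w =
     tmult_cost H11 w + tmult_cost H12 w + tmult_cost H21 w + tmult_cost H22 w
     + ncols (Blocks H11 H12 H21 H22) * w"

definition hcat :: "complex mat \<Rightarrow> complex mat \<Rightarrow> complex mat" where
  "hcat A B = four_block_mat A B (0\<^sub>m 0 (dim_col A)) (0\<^sub>m 0 (dim_col B))"

definition row_slice :: "complex mat \<Rightarrow> nat \<Rightarrow> nat \<Rightarrow> complex mat" where
  "row_slice U i l = mat l (dim_col U) (\<lambda>(r, c). U $$ (i + r, c))"

text \<open>Adds a factorized matrix to a stored matrix without changing the block structure. Low-rank
  blocks are updated by concatenation of the factors, which takes no arithmetic operations; no
  recompression is done.\<close>
fun add_factors :: "hmat \<Rightarrow> factors \<Rightarrow> hmat" where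
  "add_factors (DenseBlk D) F = DenseBlk (D + fmat F)"
| "add_factors (LowRankBlk G) F = LowRankBlk (hcat (fst G) (fst F), hcat (snd G) (snd F))"
| "add_factors (Blocks H11 H12 H21 H22) F =
     (let U1 = row_slice (fst F) 0 (nrows H11); U2 = row_slice (fst F) (nrows H11) (nrows H22);
          V1 = row_slice (snd F) 0 (ncols H11); V2 = row_slice (snd F) (ncols H11) (ncols H22)
      in Blocks (add_factors H11 (U1, V1)) (add_factors H12 (U1, V2))
                (add_factors H21 (U2, V1)) (add_factors H22 (U2, V2)))"

fun add_cost :: "hmat \<Rightarrow> nat \<Rightarrow> nat" where
  "add_cost (DenseBlk D) w = 2 * dim_row D * dim_col D * w"
| "add_cost (LowRankBlk G) w = 0"
| "add_cost (Blocks H11 H12 H21 H22) w =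
     add_cost H11 w + add_cost H12 w + add_cost H21 w + add_cost H22 w"

text \<open>Factorization \<open>P * Q\<^sup>T\<close> of the matrix with zero diagonal blocks and the given factorized
  off-diagonal blocks 12 and 21.\<close>
definition off_diag :: "factors \<Rightarrow> factors \<Rightarrow> factors" where
  "off_diag F12 F21 =
     (four_block_mat (fst F12) (0\<^sub>m (dim_row (fst F12)) (dim_col (fst F21)))
                     (0\<^sub>m (dim_row (fst F21)) (dim_col (fst F12))) (fst F21),
      four_block_mat (0\<^sub>m (dim_row (snd F21)) (dim_col (snd F12))) (snd F21)
                     (snd F12) (0\<^sub>m (dim_row (snd F12)) (dim_col (snd F21))))"

text \<open>If \<open>P * Q\<^sup>T\<close> and \<open>R * S\<^sup>T\<close> are the off-diagonal parts of \<open>A\<close> and \<open>B\<close>, then the new right-hand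
  side is \<open>- P Q\<^sup>T X - X R S\<^sup>T = [- P, - X R] [X\<^sup>T Q, S]\<^sup>T\<close>.\<close>
definition coupling_rhs :: "factors \<Rightarrow> factors \<Rightarrow> hmat \<Rightarrow> factors" where
  "coupling_rhs PQ RS X =
     (hcat (- fst PQ) (- (mat_of X * fst RS)), hcat (transpose_mat (mat_of X) * snd PQ) (snd RS))"

definition coupling_cost :: "factors \<Rightarrow> factors \<Rightarrow> hmat \<Rightarrow> nat" where
  "coupling_cost PQ RS X =
     tmult_cost X (width PQ) + mult_cost X (width RS) + nrows X * (width PQ + width RS)"

text \<open>\<open>correction LR A B X X' t\<close>: from the solution \<open>X\<close> of the decoupled equation form the new
  right-hand side, solve for the low-rank correction, and add it.\<close>
inductive correction :: "lr_solver \<Rightarrow> hmat \<Rightarrow> hmat \<Rightarrow> hmat \<Rightarrow> hmat \<Rightarrow> nat \<Rightarrow> bool" for LR where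
  "\<lbrakk> A = Blocks A11 (LowRankBlk A12) (LowRankBlk A21) A22;
     B = Blocks B11 (LowRankBlk B12) (LowRankBlk B21) B22;
     PQ = off_diag A12 A21; RS = off_diag B12 B21;
     LR A B (coupling_rhs PQ RS X) D t \<rbrakk>
   \<Longrightarrow> correction LR A B X (add_factors X D)
         (coupling_cost PQ RS X + t + add_cost X (width D))"


section \<open>The divide-and-conquer algorithms\<close>

text \<open>\<open>dense_rhs_sylv LR DS A B C X t\<close>: DenseRHS\_Sylv on \<open>A\<close>, \<open>B\<close>, \<open>C\<close> returns \<open>X\<close> after \<open>t\<close>
  operations.\<close>
inductive dense_rhs_sylv ::
    "lr_solver \<Rightarrow> dense_solver \<Rightarrow> hmat \<Rightarrow> hmat \<Rightarrow> complex mat \<Rightarrow> complex mat \<Rightarrow> nat \<Rightarrow> bool"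
  for LR DS where
  base: "DS A B C X t \<Longrightarrow> dense_rhs_sylv LR DS (DenseBlk A) (DenseBlk B) C X t"
| step: "\<lbrakk> A = Blocks A11 A12 A21 A22; B = Blocks B11 B12 B21 B22;
     C = four_block_mat C11 C12 C21 C22;
     C11 \<in> carrier_mat (nrows A11) (ncols B11); C12 \<in> carrier_mat (nrows A11) (ncols B22);
     C21 \<in> carrier_mat (nrows A22) (ncols B11); C22 \<in> carrier_mat (nrows A22) (ncols B22);
     dense_rhs_sylv LR DS A11 B11 C11 X11 t11; dense_rhs_sylv LR DS A11 B22 C12 X12 t12;
     dense_rhs_sylv LR DS A22 B11 C21 X21 t21; dense_rhs_sylv LR DS A22 B22 C22 X22 t22;
     correction LR A B
       (Blocks (DenseBlk X11) (DenseBlk X12) (DenseBlk X21) (DenseBlk X22)) X t \<rbrakk>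
   \<Longrightarrow> dense_rhs_sylv LR DS A B C (mat_of X) (t11 + t12 + t21 + t22 + t)"

text \<open>\<open>dc_sylv LR DS A B C X t\<close>: D\&C\_Sylv on \<open>A\<close>, \<open>B\<close>, \<open>C\<close> returns \<open>X\<close> after \<open>t\<close> operations. The
  conditions on the block sizes in rule \<open>step\<close> say that the partitioning of \<open>C\<close> is also the one of
  the HODLR matrices \<open>A\<close> and \<open>B\<close>; otherwise the blocks of \<open>A\<close> and \<open>B\<close> are not available as HODLR
  matrices and there is no run.\<close>
inductive dc_sylv ::
    "lr_solver \<Rightarrow> dense_solver \<Rightarrow> hmat \<Rightarrow> hmat \<Rightarrow> hmat \<Rightarrow> hmat \<Rightarrow> nat \<Rightarrow> bool"
  for LR DS where
  low_rank: "LR A B F X t \<Longrightarrow> dc_sylv LR DS A B (LowRankBlk F) (LowRankBlk X) t"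
| dense: "dense_rhs_sylv LR DS A B D X t \<Longrightarrow> dc_sylv LR DS A B (DenseBlk D) (DenseBlk X) t"
| step: "\<lbrakk> A = Blocks A11 A12 A21 A22; B = Blocks B11 B12 B21 B22; C = Blocks C11 C12 C21 C22;
     nrows C11 = nrows A11; ncols C11 = ncols B11; nrows C12 = nrows A11; ncols C12 = ncols B22;
     nrows C21 = nrows A22; ncols C21 = ncols B11; nrows C22 = nrows A22; ncols C22 = ncols B22;
     dc_sylv LR DS A11 B11 C11 X11 t11; dc_sylv LR DS A11 B22 C12 X12 t12;
     dc_sylv LR DS A22 B11 C21 X21 t21; dc_sylv LR DS A22 B22 C22 X22 t22;
     correction LR A B (Blocks X11 X12 X21 X22) X t \<rbrakk>
   \<Longrightarrow> dc_sylv LR DS A B C X (t11 + t12 + t21 + t22 + t)"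

text \<open>The minimal blocks are square of size \<open>nmin\<close>, up to a factor of at most \<open>c\<close>. For \<open>c = 1\<close> all
  of them have size exactly \<open>nmin\<close>; \<open>c = 2\<close> allows for repeated bisection of an arbitrary \<open>n\<close>.\<close>
definition minimal_block_size :: "real \<Rightarrow> nat \<Rightarrow> cluster \<Rightarrow> bool" where
  "minimal_block_size c nmin T \<longleftrightarrow>
     (\<forall>(a, b) \<in> dense_sizes T. a = b \<and> nmin \<le> a \<and> real a \<le> c * real nmin)"

end

theory Submission
  imports Defs
begin

text \<open>The cost of every call of D\&C\_Sylv and DenseRHS\_Sylv is charged to the storage of its own
  block of \<open>C\<close>. There are \<open>O(log n)\<close> levels, and each of them adds \<open>O(k)\<close> columns to the low-rank
  blocks of \<open>X\<close>, so the products with \<open>X\<close> cost \<open>O(S k\<^sup>2 log n)\<close> per level. The summand of size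
  \<open>k\<^sup>2 log\<^sup>2 n (a + b)\<close> caused by the low-rank solver on an \<open>a \<times> b\<close> block is summed over all levels
  at once: the four children of a block have together twice its numbers of rows and columns, hence
  the sum over all inner nodes of \<open>a + b\<close> is at most the sum over all leaves. Inside a dense block
  the total of \<open>a + b\<close> doubles from level to level, which is still dominated by the number of entries.\<close>

section \<open>Shapes\<close>

lemma dims_fmat [simp]:
  "dim_row (fmat F) = dim_row (fst F)" "dim_col (fmat F) = dim_row (snd F)"
  by (simp_all add: fmat_def)

lemma factors_shapeD:
  assumes "factors_shape a b F"
  shows "dim_row (fst F) = a" "dim_row (snd F) = b" "dim_col (fst F) = width F"
    "dim_col (snd F) = width F"
  using assms by (auto simp: factors_shape_def)

lemma factors_shapeI:
  "dim_row (fst F) = a \<Longrightarrow> dim_row (snd F) = b \<Longrightarrow> dim_col (snd F) = dim_col (fst F) \<Longrightarrow>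
    factors_shape a b F"
  by (auto simp: factors_shape_def width_def)

lemma dims_hcat [simp]:
  "dim_row (hcat A B) = dim_row A" "dim_col (hcat A B) = dim_col A + dim_col B"
  by (simp_all add: hcat_def)

lemma dims_row_slice [simp]:
  "dim_row (row_slice U i l) = l" "dim_col (row_slice U i l) = dim_col U"
  by (simp_all add: row_slice_def)

lemma quad_tree_valid: "quad_tree T \<Longrightarrow> valid_interval (row_ivl T) \<and> valid_interval (col_ivl T)"
  by (cases T) auto

lemma ilen_pos: "valid_interval I \<Longrightarrow> 0 < ilen I"
  by (auto simp: valid_interval_def ilen_def)

lemma ilen_splits:
  assumes "splits I I1 I2" "valid_interval I1" "valid_interval I2"
  shows "ilen I = ilen I1 + ilen I2"
  using assms by (auto simp: splits_def valid_interval_def ilen_def)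

lemma dims_stores:
  "stores T M H \<Longrightarrow> quad_tree T \<Longrightarrow> nrows H = ilen (row_ivl T) \<and> ncols H = ilen (col_ivl T)"
proof (induction T M H rule: stores.induct)
  case (1 I J M D)
  then show ?case by (simp add: block_def)
next
  case (2 I J M F)
  then show ?case by (simp add: block_def)
next
  case (3 I J T11 T12 T21 T22 M H11 H12 H21 H22)
  \<comment> \<open>A four-block matrix takes its dimensions from the blocks 11 and 22, so the
    splits seen by these two suffice.\<close>
  have "ilen I = ilen (row_ivl T11) + ilen (row_ivl T22)"
    "ilen J = ilen (col_ivl T11) + ilen (col_ivl T22)"
    using 3(6) quad_tree_valid[of T11] quad_tree_valid[of T22]
    by (auto intro: ilen_splits)
  with 3 show ?case by auto
qed auto

lemma storesE_leaf:
  assumes "stores (Leaf I J l) M H"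
  obtains (dense) "l = Dense" "H = DenseBlk (block M I J)"
  | (low_rank) F where "l = LowRank" "H = LowRankBlk F" "factors_shape (ilen I) (ilen J) F"
      "width F = max 1 (mrank (block M I J))"
  using assms by (cases l; cases H) auto

lemma storesE_node:
  assumes "stores (Node I J T11 T12 T21 T22) M H"
  obtains H11 H12 H21 H22 where "H = Blocks H11 H12 H21 H22"
    "stores T11 M H11" "stores T12 M H12" "stores T21 M H21" "stores T22 M H22"
  using assms by (cases H) auto

text \<open>True of stored matrices because a zero block is stored with one column.\<close>
fun nonempty_factors :: "hmat \<Rightarrow> bool" where
  "nonempty_factors (DenseBlk D) \<longleftrightarrow> True"
| "nonempty_factors (LowRankBlk F) \<longleftrightarrow>
     1 \<le> width F \<and> factors_shape (dim_row (fst F)) (dim_row (snd F)) F"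
| "nonempty_factors (Blocks H11 H12 H21 H22) \<longleftrightarrow>
     nonempty_factors H11 \<and> nonempty_factors H12 \<and> nonempty_factors H21 \<and> nonempty_factors H22"

lemma stores_nonempty_factors: "stores T M H \<Longrightarrow> nonempty_factors H"
  by (induction T M H rule: stores.induct) (auto simp: factors_shape_def)


section \<open>HODLR coefficients\<close>

text \<open>Here \<open>q\<close> counts the levels below the root, so the cluster has depth \<open>q + 1\<close>.\<close>
definition hodlr_stored :: "real \<Rightarrow> nat \<Rightarrow> nat \<Rightarrow> nat \<Rightarrow> hmat \<Rightarrow> bool" where
  "hodlr_stored c m k q A \<longleftrightarrow>
     (\<exists>T M. quad_tree T \<and> hodlr_cluster (Suc q) T \<and> minimal_block_size c m T \<and> halr T k M \<and>
        stores T M A)"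

lemma hodlr_stored_DenseBlk:
  assumes "hodlr_stored c m k q (DenseBlk D)"
  shows "q = 0" "square_mat D" "1 \<le> dim_row D" "m \<le> dim_row D" "real (dim_row D) \<le> c * real m"
proof -
  obtain T M where T: "quad_tree T" "hodlr_cluster (Suc q) T" "minimal_block_size c m T"
    "stores T M (DenseBlk D)"
    using assms unfolding hodlr_stored_def by blast
  then obtain I J where TL: "T = Leaf I J Dense" "D = block M I J"
    by (cases T) (auto elim: storesE_leaf storesE_node)
  have "dim_row D = ilen I" "dim_col D = ilen J"
    using TL by (simp_all add: block_def)
  then show "q = 0" "square_mat D" "1 \<le> dim_row D" "m \<le> dim_row D" "real (dim_row D) \<le> c * real m"
    using T TL ilen_pos[of I] by (simp_all add: minimal_block_size_def)
qed

lemma hodlr_stored_LowRankBlk: "\<not> hodlr_stored c m k q (LowRankBlk F)"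
  unfolding hodlr_stored_def
proof clarify
  fix T M
  assume "hodlr_cluster (Suc q) T" "stores T M (LowRankBlk F)"
  then show False
    by (cases T) (auto elim: storesE_leaf storesE_node)
qed

lemma hodlr_stored_Blocks:
  assumes "hodlr_stored c m k q (Blocks A11 A12 A21 A22)" and "1 \<le> k"
  obtains q' F12 F21 where "q = Suc q'" "hodlr_stored c m k q' A11" "hodlr_stored c m k q' A22"
    "A12 = LowRankBlk F12" "factors_shape (nrows A11) (ncols A22) F12" "width F12 \<le> k"
    "A21 = LowRankBlk F21" "factors_shape (nrows A22) (ncols A11) F21" "width F21 \<le> k"
proof -
  obtain T M where T: "quad_tree T" "hodlr_cluster (Suc q) T" "minimal_block_size c m T"
    "halr T k M" "stores T M (Blocks A11 A12 A21 A22)"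
    using assms unfolding hodlr_stored_def by blast
  from T(5) obtain I J T11 T12 T21 T22 where TN: "T = Node I J T11 T12 T21 T22"
    by (cases T) (auto elim: storesE_leaf)
  from T(2) obtain q' where q': "q = Suc q'"
    by (cases q) (auto simp: TN)
  obtain I12 J12 I21 J21 where L: "T12 = Leaf I12 J12 LowRank" "T21 = Leaf I21 J21 LowRank"
    using T(2) by (auto simp: TN)
  have st: "stores T11 M A11" "stores T12 M A12" "stores T21 M A21" "stores T22 M A22"
    using T(5) by (simp_all add: TN)
  have qt: "quad_tree T11" "quad_tree T22"
    using T(1) by (simp_all add: TN)
  have ivl: "I12 = row_ivl T11" "J12 = col_ivl T22" "I21 = row_ivl T22" "J21 = col_ivl T11"
    using T(1) by (auto simp: TN L)
  obtain F12 where F12: "A12 = LowRankBlk F12" "factors_shape (ilen I12) (ilen J12) F12"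
    "width F12 = max 1 (mrank (block M I12 J12))"
    using st(2) unfolding L by (auto elim: storesE_leaf)
  obtain F21 where F21: "A21 = LowRankBlk F21" "factors_shape (ilen I21) (ilen J21) F21"
    "width F21 = max 1 (mrank (block M I21 J21))"
    using st(3) unfolding L by (auto elim: storesE_leaf)
  have "hodlr_cluster (Suc q') T11" "minimal_block_size c m T11" "halr T11 k M"
    "hodlr_cluster (Suc q') T22" "minimal_block_size c m T22" "halr T22 k M"
    using T(2-4) by (simp_all add: TN q' minimal_block_size_def)
  then have "hodlr_stored c m k q' A11" "hodlr_stored c m k q' A22"
    using st qt unfolding hodlr_stored_def by blast+
  \<comment> \<open>Here \<open>1 \<le> k\<close> enters: a zero block is stored with one column,
    and the width \<open>max 1 r\<close> of a block of rank \<open>r \<le> k\<close> is still at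
    most \<open>k\<close>.\<close>
  moreover have "width F12 \<le> k" "width F21 \<le> k"
    using T(4) assms(2) by (auto simp: TN L F12 F21)
  ultimately show thesis
    using that[OF q', of F12 F21] F12 F21 dims_stores[OF st(1) qt(1)] dims_stores[OF st(4) qt(2)] ivl
    by auto
qed

text \<open>All dense leaves of a HODLR cluster lie on the same level \<open>q\<close>, so the size
  is a sum of \<open>2 ^ q\<close> minimal blocks, each between \<open>m\<close> and
  \<open>c * m\<close>. The lower bound serves to compare terms with the number of entries of a
  dense block, the upper one to bound the row and column numbers met in the recursion.\<close>

lemma hodlr_stored_dims:
  assumes "hodlr_stored c m k q A" and "1 \<le> k"
  shows "ncols A = nrows A" "1 \<le> nrows A" "2 ^ q * m \<le> nrows A"
    "real (nrows A) \<le> c * 2 ^ q * real m"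
proof -
  have "ncols A = nrows A \<and> 1 \<le> nrows A \<and> 2 ^ q * m \<le> nrows A
      \<and> real (nrows A) \<le> c * 2 ^ q * real m"
    using assms(1)
  proof (induction A arbitrary: q)
    case (DenseBlk D)
    from hodlr_stored_DenseBlk[OF this] show ?case by simp
  next
    case (LowRankBlk F)
    then show ?case by (simp add: hodlr_stored_LowRankBlk)
  next
    case (Blocks A11 A12 A21 A22)
    from hodlr_stored_Blocks[OF Blocks.prems assms(2)] obtain q' where
      "q = Suc q'" "hodlr_stored c m k q' A11" "hodlr_stored c m k q' A22" .
    with Blocks.IH(1,4) show ?case
      by (fastforce simp: algebra_simps)
  qed
  then show "ncols A = nrows A" "1 \<le> nrows A" "2 ^ q * m \<le> nrows A"
    "real (nrows A) \<le> c * 2 ^ q * real m"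
    by auto
qed

lemma hodlr_stored_imp_stored_hodlr:
  "hodlr_stored c m k q A \<Longrightarrow> 1 \<le> k \<Longrightarrow> stored_hodlr k A"
  using hodlr_stored_dims(1)[of c m k q A] unfolding hodlr_stored_def stored_hodlr_def by metis


section \<open>Cost of the arithmetic\<close>

text \<open>Linearity lets costs be measured per column, so that only the case of a single column
  has to be compared with the storage.\<close>

lemma mult_cost_linear: "mult_cost H w = mult_cost H 1 * w"
  by (induction H) (auto simp: algebra_simps)

lemma tmult_cost_linear: "tmult_cost H w = tmult_cost H 1 * w"
  by (induction H) (auto simp: algebra_simps)

lemma add_cost_linear: "add_cost H w = add_cost H 1 * w"
  by (induction H) (auto simp: algebra_simps)

text \<open>\<open>X\<close> has the block structure of \<open>C\<close>, and its low-rank blocks have at most \<open>e\<close> columns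
  more than \<open>\<kappa>\<close> times those of \<open>C\<close>.\<close>
fun same_blocks :: "real \<Rightarrow> real \<Rightarrow> hmat \<Rightarrow> hmat \<Rightarrow> bool" where
  "same_blocks \<kappa> e (DenseBlk D) (DenseBlk Y) \<longleftrightarrow>
     dim_row Y = dim_row D \<and> dim_col Y = dim_col D \<and> 1 \<le> dim_row D \<and> 1 \<le> dim_col D"
| "same_blocks \<kappa> e (LowRankBlk F) (LowRankBlk G) \<longleftrightarrow>
     dim_row (fst G) = dim_row (fst F) \<and> dim_row (snd G) = dim_row (snd F) \<and>
     1 \<le> width F \<and> real (width G) \<le> \<kappa> * real (width F) + e"
| "same_blocks \<kappa> e (Blocks C11 C12 C21 C22) (Blocks X11 X12 X21 X22) \<longleftrightarrow>
     nrows C12 = nrows C11 \<and> nrows C21 = nrows C22 \<and>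
     ncols C21 = ncols C11 \<and> ncols C12 = ncols C22 \<and>
     same_blocks \<kappa> e C11 X11 \<and> same_blocks \<kappa> e C12 X12 \<and>
     same_blocks \<kappa> e C21 X21 \<and> same_blocks \<kappa> e C22 X22"
| "same_blocks _ _ _ _ \<longleftrightarrow> False"

lemma same_blocks_dims: "same_blocks \<kappa> e C X \<Longrightarrow> nrows X = nrows C \<and> ncols X = ncols C"
  by (induction \<kappa> e C X rule: same_blocks.induct) auto

text \<open>Concatenation appends \<open>width F\<close> columns to every low-rank block.
  Corrections thus increase only the additive part \<open>e\<close>, while \<open>\<kappa>\<close>
  remains the growth caused by the solver at the leaves.\<close>

lemma same_blocks_add_factors:
  "same_blocks \<kappa> e C X \<Longrightarrow> dim_row (fst F) = nrows C \<Longrightarrow> dim_row (snd F) = ncols C \<Longrightarrow>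
    real (width F) \<le> w \<Longrightarrow> same_blocks \<kappa> (e + w) C (add_factors X F)"
proof (induction \<kappa> e C X arbitrary: F rule: same_blocks.induct)
  case (3 \<kappa> e C11 C12 C21 C22 X11 X12 X21 X22)
  have "nrows X11 = nrows C11" "ncols X11 = ncols C11" "nrows X22 = nrows C22" "ncols X22 = ncols C22"
    using 3(5) by (auto dest: same_blocks_dims)
  with 3 show ?case
    by (auto simp: Let_def width_def)
qed (auto simp: width_def)

section \<open>Products with X and updates of X bounded by the storage of C\<close>

text \<open>\<open>v\<close> and \<open>w\<close> are the widths of a block in \<open>X\<close> and
  in \<open>C\<close>. Since \<open>w\<close> is at least 1, \<open>e\<close> may be multiplied by
  \<open>w\<close>; this is where a zero block stored with one column counts. The factor 3 is 2 for
  the product plus 1 for the dimension \<open>d\<close> carried by the inductions below.\<close>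

lemma low_rank_block_cost:
  fixes \<kappa> e :: real
  assumes "1 \<le> \<kappa>" "0 \<le> e" "1 \<le> w" "real v \<le> \<kappa> * real w + e" "d \<le> a + b"
  shows "real (2 * (a + b) * v + d) \<le> 3 * (\<kappa> + e) * real ((a + b) * w)"
proof -
  have "real v \<le> (\<kappa> + e) * real w"
    using assms mult_left_mono[of 1 "real w" e] by (simp add: algebra_simps)
  then have "real (a + b) * real v \<le> real (a + b) * ((\<kappa> + e) * real w)"
    by (rule mult_left_mono) simp
  moreover have "1 * 1 \<le> (\<kappa> + e) * real w"
    using assms by (intro mult_mono) auto
  then have "real (a + b) * 1 \<le> real (a + b) * ((\<kappa> + e) * real w)"
    by (intro mult_left_mono) auto
  ultimately show ?thesis
    using assms(5) by (simp add: algebra_simps)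
qed

lemma dense_block_cost:
  fixes \<kappa> e :: real
  assumes "1 \<le> \<kappa>" "0 \<le> e" "1 \<le> a" "1 \<le> b" "d \<le> max a b"
  shows "real (2 * a * b + d) \<le> 3 * (\<kappa> + e) * real (a * b)"
proof -
  have "a \<le> a * b" "b \<le> a * b"
    using assms by simp_all
  then have "real (2 * a * b + d) \<le> 3 * 1 * real (a * b)"
    using assms(5) unfolding of_nat_mult[symmetric] by linarith
  also have "\<dots> \<le> 3 * (\<kappa> + e) * real (a * b)"
    using assms by (intro mult_right_mono) auto
  finally show ?thesis .
qed

text \<open>The row number on the left-hand side makes the induction work: it absorbs the additions of
  partial products at the inner nodes.\<close>
lemma mult_cost_le_storage:
  assumes "same_blocks \<kappa> e C X" "1 \<le> \<kappa>" "0 \<le> e"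
  shows "real (mult_cost X 1 + nrows X) \<le> 3 * (\<kappa> + e) * real (storage C)"
  using assms
proof (induction \<kappa> e C X rule: same_blocks.induct)
  case (3 \<kappa> e C11 C12 C21 C22 X11 X12 X21 X22)
  \<comment> \<open>The row numbers of the four children add up to twice that of the node: one copy
    pays for adding the partial products, the other stays on the left-hand side.\<close>
  have "nrows X12 = nrows X11" "nrows X21 = nrows X22"
    using 3(5) by (auto dest!: same_blocks_dims)
  with 3 show ?case by (simp add: algebra_simps)
next
  case (1 \<kappa> e D Y)
  then show ?case
    using dense_block_cost[of \<kappa> e "dim_row D" "dim_col D" "dim_row D"] by simp
next
  case (2 \<kappa> e F G)
  then show ?case
    using low_rank_block_cost[of \<kappa> e "width F" "width G" "dim_row (fst F)" "dim_row (fst F)" "dim_row (snd F)"]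
    by simp
qed auto

lemma tmult_cost_le_storage:
  assumes "same_blocks \<kappa> e C X" "1 \<le> \<kappa>" "0 \<le> e"
  shows "real (tmult_cost X 1 + ncols X) \<le> 3 * (\<kappa> + e) * real (storage C)"
  using assms
proof (induction \<kappa> e C X rule: same_blocks.induct)
  case (3 \<kappa> e C11 C12 C21 C22 X11 X12 X21 X22)
  have "ncols X21 = ncols X11" "ncols X12 = ncols X22"
    using 3(5) by (auto dest!: same_blocks_dims)
  with 3 show ?case by (simp add: algebra_simps)
next
  case (1 \<kappa> e D Y)
  then show ?case
    using dense_block_cost[of \<kappa> e "dim_row D" "dim_col D" "dim_col D"] by simp
next
  case (2 \<kappa> e F G)
  then show ?case
    using low_rank_block_cost[of \<kappa> e "width F" "width G" "dim_row (snd F)" "dim_row (fst F)" "dim_row (snd F)"]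
    by simp
qed auto

lemma add_cost_le_storage: "same_blocks \<kappa> e C X \<Longrightarrow> add_cost X 1 \<le> 2 * storage C"
  by (induction \<kappa> e C X rule: same_blocks.induct) auto


section \<open>The recursions\<close>

text \<open>One instance with the constants of its solvers. \<open>L\<close> plays the logarithm of
  the size \<open>n\<close> of the whole problem and replaces the logarithm of each subproblem. The
  larger of the two sizes is replaced by their sum, because sums add up over the four children and
  maxima do not.\<close>

locale sylvester_run =
  fixes LR :: lr_solver and DS :: dense_solver and c c2 \<kappa> \<kappa>d L :: real and n m k :: nat
  assumes lr_shape: "low_rank_rhs_solver LR"
    and lr_cost: "\<lbrakk>stored_hodlr k A; stored_hodlr k B; factors_shape (nrows A) (nrows B) F;
        LR A B F X t; nrows A \<le> n; nrows B \<le> n\<rbrakk> \<Longrightarrow>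
        real t \<le> \<kappa> * (real (width F) * real k * real (nrows A + nrows B) * L
                     + (real k)\<^sup>2 * real (nrows A + nrows B) * L\<^sup>2)
        \<and> real (width X) \<le> \<kappa> * real (width F)"
    and ds: "\<lbrakk>DS A' B' D Y t; square_mat A'; square_mat B';
        D \<in> carrier_mat (dim_row A') (dim_row B')\<rbrakk> \<Longrightarrow>
        Y \<in> carrier_mat (dim_row A') (dim_row B') \<and>
        real t \<le> \<kappa>d * real (max (dim_row A') (dim_row B')) ^ 3"
    and const_bounds: "1 \<le> c" "0 \<le> c2" "1 \<le> \<kappa>" "0 \<le> \<kappa>d" "1 \<le> L" "1 \<le> k"
begin

abbreviation hodlr :: "nat \<Rightarrow> hmat \<Rightarrow> bool" where "hodlr \<equiv> hodlr_stored c m k"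
abbreviation E :: real where "E \<equiv> (real k)\<^sup>2 * L\<^sup>2"

section \<open>Cost of one correction\<close>

lemma k_le: "real k \<le> (real k)\<^sup>2" and L_le: "L \<le> L\<^sup>2"
  using const_bounds by (simp_all add: power2_eq_square)

text \<open>The off-diagonal parts of \<open>A\<close> and \<open>B\<close> are factorized with at
  most \<open>2 * k\<close> columns each, so the new right-hand side has at most
  \<open>4 * k\<close> columns and the correction at most \<open>4 * \<kappa> * k\<close>. The
  products are linear in these widths. The low-rank solve is kept as a separate term because it
  scales with rows plus columns instead of storage.\<close>

lemma correction_cost:
  assumes "correction LR A B X Y t" and A: "hodlr q A" and B: "hodlr q' B"
    and dims: "nrows X = nrows A" "ncols X = nrows B" "nrows A \<le> n" "nrows B \<le> n"
  obtains D where "Y = add_factors X D" "dim_row (fst D) = nrows X" "dim_row (snd D) = ncols X"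
    "real (width D) \<le> 4 * \<kappa> * real k"
    "real t \<le> 4 * \<kappa> * real k * real (tmult_cost X 1 + mult_cost X 1 + nrows X + add_cost X 1)
       + 5 * \<kappa> * E * real (nrows A + nrows B)"
  using assms(1)
proof cases
  case (1 A11 A12 A21 A22 B11 B12 B21 B22 PQ RS D t')
  from hodlr_stored_Blocks[OF A[unfolded 1(3)] const_bounds(6)] obtain
    A': "factors_shape (nrows A11) (ncols A22) A12" "width A12 \<le> k"
      "factors_shape (nrows A22) (ncols A11) A21" "width A21 \<le> k"
    by (metis hmat.inject(2))
  from hodlr_stored_Blocks[OF B[unfolded 1(4)] const_bounds(6)] obtain
    B': "factors_shape (nrows B11) (ncols B22) B12" "width B12 \<le> k"
      "factors_shape (nrows B22) (ncols B11) B21" "width B21 \<le> k"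
    by (metis hmat.inject(2))
  have sq: "nrows A = ncols A" "nrows B = ncols B"
    using hodlr_stored_dims(1) A B const_bounds(6) by metis+
  let ?F = "coupling_rhs PQ RS X"
  have w: "width PQ = width A12 + width A21" "width RS = width B12 + width B21"
    "width ?F = width PQ + width RS"
    unfolding 1(5,6) by (simp_all add: off_diag_def width_def coupling_rhs_def)
  have shapeF: "factors_shape (nrows A) (nrows B) ?F"
    using dims sq A'(1,3)[THEN factors_shapeD(1)]
      A'(1,3)[THEN factors_shapeD(4), unfolded width_def]
      B'(1,3)[THEN factors_shapeD(4), unfolded width_def]
    by (intro factors_shapeI) (simp_all add: 1(3,5,6) off_diag_def coupling_rhs_def)
  have LRcall: "LR A B ?F D t'"
    using 1 by simp
  have st: "stored_hodlr k A" "stored_hodlr k B"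
    using hodlr_stored_imp_stored_hodlr A B const_bounds(6) by blast+
  have shapeD: "factors_shape (nrows A) (nrows B) D"
    using lr_shape LRcall sq shapeF unfolding low_rank_rhs_solver_def by blast
  note lr = lr_cost[OF st shapeF LRcall dims(3,4)]
  have w4: "real (width PQ) \<le> 2 * real k" "real (width RS) \<le> 2 * real k"
      "real (width ?F) \<le> 4 * real k"
    using A'(2,4) B'(2,4) w by simp_all
  have \<kappa>: "0 \<le> \<kappa>" "1 * real k \<le> \<kappa> * real k"
    using const_bounds by (auto intro: mult_right_mono)
  have wD: "real (width D) \<le> 4 * \<kappa> * real k"
    using lr mult_left_mono[OF w4(3) \<kappa>(1)] by simp
  \<comment> \<open>Origin of the constant 5: with at most \<open>4 * k\<close> columns and
    \<open>L \<le> L\<^sup>2\<close> the first term of the solver's bound yields 4 times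
    \<open>E\<close>, and the second term is \<open>E\<close> itself.\<close>
  have "real (width ?F) * real k * real (nrows A + nrows B) * L
      \<le> (4 * real k) * real k * real (nrows A + nrows B) * L\<^sup>2"
    using w4(3) L_le const_bounds by (intro mult_mono) auto
  then have "\<kappa> * (real (width ?F) * real k * real (nrows A + nrows B) * L)
      \<le> \<kappa> * ((4 * real k) * real k * real (nrows A + nrows B) * L\<^sup>2)"
    using \<kappa>(1) by (rule mult_left_mono)
  then have t': "real t' \<le> 5 * \<kappa> * E * real (nrows A + nrows B)"
    using lr by (simp add: algebra_simps power2_eq_square)
  have bounds: "real (width PQ) \<le> 4 * \<kappa> * real k" "real (width RS) \<le> 4 * \<kappa> * real k"
    "real (width PQ + width RS) \<le> 4 * \<kappa> * real k"
    using w4 \<kappa> w by simp_all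
  have "real (tmult_cost X (width PQ)) \<le> 4 * \<kappa> * real k * real (tmult_cost X 1)"
    "real (mult_cost X (width RS)) \<le> 4 * \<kappa> * real k * real (mult_cost X 1)"
    "real (add_cost X (width D)) \<le> 4 * \<kappa> * real k * real (add_cost X 1)"
    "real (nrows X * (width PQ + width RS)) \<le> 4 * \<kappa> * real k * real (nrows X)"
    using bounds wD
    by (auto simp: tmult_cost_linear[of X "width PQ"] mult_cost_linear[of X "width RS"]
        add_cost_linear[of X "width D"] mult.commute[of _ "real (width _)"]
        mult.commute[of "real (nrows X)"] simp del: of_nat_add intro!: mult_right_mono)
  then have "real t \<le> 4 * \<kappa> * real k * real (tmult_cost X 1 + mult_cost X 1 + nrows X + add_cost X 1)
       + 5 * \<kappa> * E * real (nrows A + nrows B)"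
    using t' unfolding 1(2) coupling_cost_def by (simp add: algebra_simps)
  then show thesis
    using that[OF 1(1) _ _ wD] shapeD dims by (simp add: factors_shapeD)
qed

section \<open>Cost of DenseRHS_Sylv\<close>

text \<open>The number of entries is additive over the four blocks, so each level adds the same
  multiple of it. The last term collects the low-rank solves: a block with \<open>q\<close> levels
  below it contributes a multiple of \<open>2 ^ q\<close>, and
  \<open>f q = 4 * f (q - 1) + 2 ^ q\<close> with \<open>f 0 = 0\<close> has the solution
  \<open>4 ^ q - 2 ^ q\<close>.\<close>

lemma dense_rhs_sylv_levels:
  assumes "dense_rhs_sylv LR DS A B C X t" "hodlr q A" "hodlr q B"
    and "C \<in> carrier_mat (nrows A) (nrows B)" "nrows A \<le> n" "nrows B \<le> n"
  shows "X \<in> carrier_mat (nrows A) (nrows B) \<and>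
    real t \<le> (\<kappa>d * c ^ 3 * real m + 36 * \<kappa> * (real k)\<^sup>2 * L * real q) * (real (nrows A) * real (nrows B))
      + 10 * \<kappa> * c * E * real m * (4 ^ q - 2 ^ q)"
  using assms
proof (induction arbitrary: q rule: dense_rhs_sylv.induct)
  case (base A B C X t)
  note A = hodlr_stored_DenseBlk[OF base(2)] and B = hodlr_stored_DenseBlk[OF base(3)]
  have run: "X \<in> carrier_mat (dim_row A) (dim_row B)"
    "real t \<le> \<kappa>d * real (max (dim_row A) (dim_row B)) ^ 3"
    using ds[OF base(1) A(2) B(2)] base(4) by simp_all
  have "real (max (dim_row A) (dim_row B)) ^ 3 \<le> (c * real m) ^ 3"
    using A(5) B(5) by (intro power_mono) auto
  also have "\<dots> = c ^ 3 * real m * (real m * real m)"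
    by (simp add: power3_eq_cube)
  \<comment> \<open>Both sizes are at least \<open>m\<close>, so two of the three factors
    \<open>m\<close> become the numbers of rows and columns, and one remains as the minimal block
    size of the final bound.\<close>
  also have "\<dots> \<le> c ^ 3 * real m * (real (dim_row A) * real (dim_row B))"
    using A(4) B(4) const_bounds by (intro mult_left_mono mult_mono) auto
  finally have "\<kappa>d * real (max (dim_row A) (dim_row B)) ^ 3
      \<le> \<kappa>d * (c ^ 3 * real m * (real (dim_row A) * real (dim_row B)))"
    using const_bounds by (intro mult_left_mono) auto
  with run A(1) show ?case by (simp add: algebra_simps)
next
  case (step A A11 A12 A21 A22 B B11 B12 B21 B22 C C11 C12 C21 C22 X11 t11 X12 t12 X21 t21 X22 t22 X t)
  from hodlr_stored_Blocks[OF step.prems(1)[unfolded step(1)] const_bounds(6)] obtain q' where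
    A: "q = Suc q'" "hodlr q' A11" "hodlr q' A22" .
  from hodlr_stored_Blocks[OF step.prems(2)[unfolded step(2)] const_bounds(6)] A(1) have
    B: "hodlr q' B11" "hodlr q' B22" by (metis nat.inject)+
  have sq: "ncols B11 = nrows B11" "ncols B22 = nrows B22"
    using hodlr_stored_dims(1) B const_bounds(6) by metis+
  have le: "nrows A11 \<le> n" "nrows A22 \<le> n" "nrows B11 \<le> n" "nrows B22 \<le> n"
    using step.prems(4,5) step(1,2) by auto
  let ?P = "\<kappa>d * c ^ 3 * real m + 36 * \<kappa> * (real k)\<^sup>2 * L * real q'"
  let ?G = "10 * \<kappa> * c * E * real m"
  note IH = step.IH(1)[OF A(2) B(1) _ le(1,3)] step.IH(2)[OF A(2) B(2) _ le(1,4)]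
    step.IH(3)[OF A(3) B(1) _ le(2,3)] step.IH(4)[OF A(3) B(2) _ le(2,4)]
  have X: "X11 \<in> carrier_mat (nrows A11) (nrows B11)" "X12 \<in> carrier_mat (nrows A11) (nrows B22)"
    "X21 \<in> carrier_mat (nrows A22) (nrows B11)" "X22 \<in> carrier_mat (nrows A22) (nrows B22)"
    using IH step(4-7) sq by auto
  have sub: "real t11 \<le> ?P * (real (nrows A11) * real (nrows B11)) + ?G * (4 ^ q' - 2 ^ q')"
    "real t12 \<le> ?P * (real (nrows A11) * real (nrows B22)) + ?G * (4 ^ q' - 2 ^ q')"
    "real t21 \<le> ?P * (real (nrows A22) * real (nrows B11)) + ?G * (4 ^ q' - 2 ^ q')"
    "real t22 \<le> ?P * (real (nrows A22) * real (nrows B22)) + ?G * (4 ^ q' - 2 ^ q')"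
    using IH step(4-7) sq by auto
  let ?X = "Blocks (DenseBlk X11) (DenseBlk X12) (DenseBlk X21) (DenseBlk X22)"
  have dims: "nrows A = nrows A11 + nrows A22" "nrows B = nrows B11 + nrows B22"
    using step(1,2) by simp_all
  have dX: "nrows ?X = nrows A" "ncols ?X = nrows B"
    using X dims by auto
  from correction_cost[OF step(12) step.prems(1,2) dX step.prems(4,5)] obtain D where
    D: "X = add_factors ?X D"
      "real t \<le> 4 * \<kappa> * real k * real (tmult_cost ?X 1 + mult_cost ?X 1 + nrows ?X + add_cost ?X 1)
         + 5 * \<kappa> * E * real (nrows A + nrows B)" .
  have carrier: "mat_of X \<in> carrier_mat (nrows A) (nrows B)"
    using X dims by (auto simp: D(1) Let_def)
  \<comment> \<open>The two products and the dense update take two operations per entry each. Adding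
    partial products costs \<open>nrows B\<close> and \<open>nrows A\<close>, and negating the
    factors costs \<open>nrows A\<close> once more.\<close>
  have "tmult_cost ?X 1 + mult_cost ?X 1 + nrows ?X + add_cost ?X 1
      = 6 * (nrows A * nrows B) + 2 * nrows A + nrows B"
    using X dims by (auto simp: algebra_simps)
  also have "\<dots> \<le> 9 * (nrows A * nrows B)"
    using hodlr_stored_dims(2)[OF step.prems(1) const_bounds(6)]
      hodlr_stored_dims(2)[OF step.prems(2) const_bounds(6)]
      mult_le_mono2[of 1 "nrows B" "nrows A"] mult_le_mono1[of 1 "nrows A" "nrows B"] by linarith
  finally have "real (tmult_cost ?X 1 + mult_cost ?X 1 + nrows ?X + add_cost ?X 1)
      \<le> 9 * (real (nrows A) * real (nrows B))"
    unfolding of_nat_mult[symmetric] by linarith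
  then have "4 * \<kappa> * real k * real (tmult_cost ?X 1 + mult_cost ?X 1 + nrows ?X + add_cost ?X 1)
      \<le> 4 * \<kappa> * real k * (9 * (real (nrows A) * real (nrows B)))"
    using const_bounds by (intro mult_left_mono) auto
  also have "\<dots> = 36 * \<kappa> * (real k * 1) * (real (nrows A) * real (nrows B))"
    by simp
  also have "\<dots> \<le> 36 * \<kappa> * ((real k)\<^sup>2 * L) * (real (nrows A) * real (nrows B))"
    using const_bounds k_le by (intro mult_left_mono mult_right_mono mult_mono) auto
  finally have t1: "4 * \<kappa> * real k * real (tmult_cost ?X 1 + mult_cost ?X 1 + nrows ?X + add_cost ?X 1)
      \<le> 36 * \<kappa> * (real k)\<^sup>2 * L * (real (nrows A) * real (nrows B))"
    by (simp add: mult.assoc)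
  have "real (nrows A + nrows B) \<le> 2 * (c * 2 ^ q * real m)"
    using hodlr_stored_dims(4)[OF step.prems(1) const_bounds(6)]
      hodlr_stored_dims(4)[OF step.prems(2) const_bounds(6)] by simp
  then have "5 * \<kappa> * E * real (nrows A + nrows B) \<le> 5 * \<kappa> * E * (2 * (c * 2 ^ q * real m))"
    using const_bounds by (intro mult_left_mono) auto
  then have t2: "5 * \<kappa> * E * real (nrows A + nrows B) \<le> ?G * 2 ^ q"
    by (simp add: algebra_simps)
  define P where "P = ?P"
  define Q where "Q = ?G"
  define R where "R = 36 * \<kappa> * (real k)\<^sup>2 * L"
  have "real t \<le> R * (real (nrows A) * real (nrows B)) + Q * 2 ^ q"
    using D(2) t1 t2 unfolding Q_def R_def by linarith
  moreover have "real t11 + real t12 + real t21 + real t22 \<le>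
      P * (real (nrows A11) * real (nrows B11)) + P * (real (nrows A11) * real (nrows B22))
      + P * (real (nrows A22) * real (nrows B11)) + P * (real (nrows A22) * real (nrows B22))
      + 4 * (Q * (4 ^ q' - 2 ^ q'))"
    using sub unfolding P_def[symmetric] Q_def[symmetric] by linarith
  moreover have "P * (real (nrows A) * real (nrows B)) =
      P * (real (nrows A11) * real (nrows B11)) + P * (real (nrows A11) * real (nrows B22))
      + P * (real (nrows A22) * real (nrows B11)) + P * (real (nrows A22) * real (nrows B22))"
    by (simp add: dims algebra_simps)
  ultimately have "real (t11 + t12 + t21 + t22 + t) \<le> P * (real (nrows A) * real (nrows B)) + 4 * (Q * (4 ^ q' - 2 ^ q'))
     + R * (real (nrows A) * real (nrows B)) + Q * 2 ^ q"
    unfolding of_nat_add by linarith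
  also have "\<dots> = (P + R) * (real (nrows A) * real (nrows B)) + Q * (4 ^ q - 2 ^ q)"
    by (simp add: A(1) algebra_simps)
  also have "P + R = \<kappa>d * c ^ 3 * real m + 36 * \<kappa> * (real k)\<^sup>2 * L * real q"
    by (simp add: P_def R_def A(1) algebra_simps)
  finally show ?case
    using carrier unfolding Q_def by blast
qed

text \<open>In order: the standard solver on minimal blocks, the products on all levels once
  \<open>q \<le> c2 * L\<close> is used, and the low-rank solves.\<close>

definition dense_const :: real where "dense_const = \<kappa>d * c ^ 3 + 36 * \<kappa> * c2 + 10 * \<kappa> * c"

text \<open>The number of levels supplies the second factor \<open>L\<close> of \<open>E\<close>.
  The growing term is harmless: both sizes are at least \<open>2 ^ q * m\<close>, so
  \<open>4 ^ q * m\<close> is at most the number of entries.\<close>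

lemma dense_rhs_sylv_cost:
  assumes "dense_rhs_sylv LR DS A B C X t" "hodlr q A" "hodlr q B"
    and "C \<in> carrier_mat (nrows A) (nrows B)" "nrows A \<le> n" "nrows B \<le> n"
    and "real q \<le> c2 * L"
  shows "X \<in> carrier_mat (nrows A) (nrows B)"
    and "real t \<le> dense_const * (real m + E) * (real (nrows A) * real (nrows B))"
proof -
  let ?ab = "real (nrows A) * real (nrows B)"
  note lev = dense_rhs_sylv_levels[OF assms(1-6)]
  show "X \<in> carrier_mat (nrows A) (nrows B)" using lev by blast
  have "2 ^ q * m * (2 ^ q * m) \<le> nrows A * nrows B"
    using hodlr_stored_dims(3)[OF assms(2) const_bounds(6)]
      hodlr_stored_dims(3)[OF assms(3) const_bounds(6)] by (rule mult_le_mono)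
  \<comment> \<open>Uses \<open>4 ^ q = 2 ^ q * 2 ^ q\<close> and \<open>m \<le> m * m\<close>,
    which holds for natural numbers.\<close>
  moreover have "4 ^ q * m \<le> 2 ^ q * m * (2 ^ q * m)"
    by (cases m) (simp_all add: power_mult_distrib[symmetric] algebra_simps)
  ultimately have "real (4 ^ q * m) \<le> real (nrows A * nrows B)"
    by (simp only: of_nat_le_iff)
  then have "real m * 4 ^ q \<le> ?ab"
    by (simp add: mult.commute)
  moreover have "0 \<le> real m * 2 ^ q" by simp
  ultimately have "real m * (4 ^ q - 2 ^ q) \<le> ?ab"
    unfolding right_diff_distrib by linarith
  then have 1: "10 * \<kappa> * c * E * (real m * (4 ^ q - 2 ^ q)) \<le> 10 * \<kappa> * c * E * ?ab"
    using const_bounds by (intro mult_left_mono) auto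
  have "36 * \<kappa> * (real k)\<^sup>2 * L * real q * ?ab \<le> 36 * \<kappa> * (real k)\<^sup>2 * L * (c2 * L) * ?ab"
    using const_bounds assms(7) by (intro mult_right_mono mult_left_mono) auto
  then have 2: "36 * \<kappa> * (real k)\<^sup>2 * L * real q * ?ab \<le> 36 * \<kappa> * c2 * E * ?ab"
    by (simp add: power2_eq_square algebra_simps)
  have "0 \<le> (36 * \<kappa> * c2 + 10 * \<kappa> * c) * real m * ?ab" "0 \<le> \<kappa>d * c ^ 3 * E * ?ab"
    using const_bounds by auto
  with lev 1 2 show "real t \<le> dense_const * (real m + E) * ?ab"
    by (simp add: dense_const_def algebra_simps)
qed

section \<open>Cost of D&C_Sylv\<close>

text \<open>\<open>4 * \<kappa>\<close> times \<open>k\<close> bounds the columns of a correction.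
  The bracket times \<open>k * L\<close> bounds the work per column and stored number: 3 for each of
  the two products, 2 for the update, and \<open>1 + 4 * c2\<close> from the growth
  \<open>\<kappa> + 4 * \<kappa> * k * q\<close> of the widths.\<close>

definition level_const :: real where "level_const = 4 * \<kappa> * (6 * \<kappa> * (1 + 4 * c2) + 2)"

text \<open>The surplus on the left equals the bound for the low-rank solve of one correction. Four
  children carry it twice in total: one copy pays for the correction, the other is the surplus of
  the node, so that storage has to pay for it at the leaves only. \<open>q\<close> counts the levels
  left in \<open>A\<close> and \<open>B\<close> and thereby bounds the number of corrections that
  reach a block of \<open>X\<close>; the tree of \<open>C\<close> may end earlier.\<close>

lemma dc_sylv_levels:
  assumes "dc_sylv LR DS A B C X t" "hodlr q A" "hodlr q B"
    and "nrows C = nrows A" "ncols C = nrows B" "nonempty_factors C" "nrows A \<le> n" "nrows B \<le> n"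
    and "real q \<le> c2 * L"
  shows "same_blocks \<kappa> (4 * \<kappa> * real k * real q) C X \<and>
    real t + 5 * \<kappa> * E * real (nrows C + ncols C) \<le>
      real (storage C) * (dense_const * (real m + E) + 17 * \<kappa> * E + level_const * (real k)\<^sup>2 * L * real q)"
  using assms
proof (induction arbitrary: q rule: dc_sylv.induct)
  case (low_rank A B F X t)
  have w: "1 \<le> width F" and F: "factors_shape (nrows A) (nrows B) F"
    using low_rank by simp_all
  have sq: "nrows A = ncols A" "nrows B = ncols B"
    using hodlr_stored_dims(1)[OF _ const_bounds(6)] low_rank(2,3) by metis+
  have st: "stored_hodlr k A" "stored_hodlr k B"
    using hodlr_stored_imp_stored_hodlr low_rank(2,3) const_bounds(6) by blast+
  note lr = lr_cost[OF st F low_rank(1,7,8)]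
  have "factors_shape (nrows A) (nrows B) X"
    using lr_shape low_rank(1) sq F unfolding low_rank_rhs_solver_def by blast
  then have "same_blocks \<kappa> (4 * \<kappa> * real k * real q) (LowRankBlk F) (LowRankBlk X)"
    using F w lr const_bounds by (simp add: factors_shapeD add_increasing2)
  \<comment> \<open>The storage is rows plus columns, times \<open>width F\<close>. The two terms of
    the solver's bound give 2, and the surplus gives 5 because \<open>width F\<close> is at least
    1.\<close>
  moreover have "real t + 5 * \<kappa> * E * real (nrows A + nrows B)
      \<le> real (storage (LowRankBlk F)) * (7 * \<kappa> * E)"
  proof -
    let ?s = "real (nrows A + nrows B)"
    have kL: "real k * L \<le> E"
      using k_le L_le const_bounds by (intro mult_mono) auto
    have "\<kappa> * real (width F) * ?s * (real k * L) \<le> \<kappa> * real (width F) * ?s * E"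
      using kL const_bounds by (intro mult_left_mono) auto
    moreover have "\<kappa> * E * ?s * 1 \<le> \<kappa> * E * ?s * real (width F)"
      using w const_bounds by (intro mult_left_mono) auto
    ultimately show ?thesis
      using lr F by (simp add: factors_shapeD algebra_simps)
  qed
  moreover have "real (storage (LowRankBlk F)) * (7 * \<kappa> * E) \<le> real (storage (LowRankBlk F)) *
      (dense_const * (real m + E) + 17 * \<kappa> * E + level_const * (real k)\<^sup>2 * L * real q)"
    using const_bounds
    by (intro mult_left_mono add_increasing2 add_increasing)
      (auto simp: dense_const_def level_const_def)
  ultimately show ?case
    using low_rank(4,5) by (simp del: storage.simps)
next
  case (dense A B D X t)
  have D: "D \<in> carrier_mat (nrows A) (nrows B)"
    using dense(4,5) by auto
  note run = dense_rhs_sylv_cost[OF dense(1,2,3) D dense(7-9)]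
  have pos: "1 \<le> nrows A" "1 \<le> nrows B"
    using hodlr_stored_dims(2)[OF dense(2) const_bounds(6)]
      hodlr_stored_dims(2)[OF dense(3) const_bounds(6)] by auto
  \<comment> \<open>On a dense block the surplus costs \<open>10 * \<kappa> * E\<close> per entry.
    Adding the 7 needed at low-rank leaves gives the 17, which serves both kinds of leaves.\<close>
  have "nrows A + nrows B \<le> 2 * (nrows A * nrows B)"
    using pos mult_le_mono2[of 1 "nrows B" "nrows A"] mult_le_mono1[of 1 "nrows A" "nrows B"]
    by linarith
  then have "real (nrows A + nrows B) \<le> 2 * (real (nrows A) * real (nrows B))"
    unfolding of_nat_mult[symmetric] by linarith
  then have "5 * \<kappa> * E * real (nrows A + nrows B) \<le> 5 * \<kappa> * E * (2 * (real (nrows A) * real (nrows B)))"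
    using const_bounds by (intro mult_left_mono) auto
  moreover have "0 \<le> 7 * \<kappa> * E * (real (nrows A) * real (nrows B))"
    "0 \<le> level_const * (real k)\<^sup>2 * L * real q * (real (nrows A) * real (nrows B))"
    using const_bounds by (auto simp: level_const_def)
  ultimately show ?case
    using run D pos by (auto simp: algebra_simps)
next
  case (step A A11 A12 A21 A22 B B11 B12 B21 B22 C C11 C12 C21 C22 X11 t11 X12 t12 X21 t21 X22 t22 X t)
  from hodlr_stored_Blocks[OF step.prems(1)[unfolded step(1)] const_bounds(6)] obtain q' where
    A: "q = Suc q'" "hodlr q' A11" "hodlr q' A22" .
  from hodlr_stored_Blocks[OF step.prems(2)[unfolded step(2)] const_bounds(6)] A(1) have
    B: "hodlr q' B11" "hodlr q' B22" by (metis nat.inject)+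
  have sq: "ncols B11 = nrows B11" "ncols B22 = nrows B22"
    using hodlr_stored_dims(1) B const_bounds(6) by metis+
  have le: "nrows A11 \<le> n" "nrows A22 \<le> n" "nrows B11 \<le> n" "nrows B22 \<le> n"
    using step.prems(6,7) step(1,2) by auto
  have q': "real q' \<le> c2 * L"
    using step.prems(8) A(1) by simp
  have ne: "nonempty_factors C11" "nonempty_factors C12" "nonempty_factors C21" "nonempty_factors C22"
    using step.prems(5) step(3) by simp_all
  note dims = step(4-11)[unfolded sq]
  let ?e = "4 * \<kappa> * real k * real q'"
  let ?P = "dense_const * (real m + E) + 17 * \<kappa> * E + level_const * (real k)\<^sup>2 * L * real q'"
  note IH = step.IH(1)[OF A(2) B(1) dims(1,2) ne(1) le(1,3) q']
    step.IH(2)[OF A(2) B(2) dims(3,4) ne(2) le(1,4) q']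
    step.IH(3)[OF A(3) B(1) dims(5,6) ne(3) le(2,3) q']
    step.IH(4)[OF A(3) B(2) dims(7,8) ne(4) le(2,4) q']
  let ?X = "Blocks X11 X12 X21 X22"
  have same: "same_blocks \<kappa> ?e C ?X"
    using IH dims step(3) by simp
  have dX: "nrows ?X = nrows A" "ncols ?X = nrows B"
    using same_blocks_dims[OF same] step.prems(3,4) by simp_all
  from correction_cost[OF step(16) step.prems(1,2) dX step.prems(6,7)] obtain D where
    D: "X = add_factors ?X D" "dim_row (fst D) = nrows ?X" "dim_row (snd D) = ncols ?X"
      "real (width D) \<le> 4 * \<kappa> * real k"
      "real t \<le> 4 * \<kappa> * real k * real (tmult_cost ?X 1 + mult_cost ?X 1 + nrows ?X + add_cost ?X 1)
         + 5 * \<kappa> * E * real (nrows A + nrows B)" .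
  have "same_blocks \<kappa> (?e + 4 * \<kappa> * real k) C X"
    unfolding D(1) using D(2-4) same_blocks_dims[OF same]
    by (intro same_blocks_add_factors[OF same]) auto
  then have sameX: "same_blocks \<kappa> (4 * \<kappa> * real k * real q) C X"
    by (simp add: A(1) algebra_simps)
  have e0: "0 \<le> ?e"
    using const_bounds by simp
  \<comment> \<open>The columns gathered over at most \<open>c2 * L\<close> levels make one product
    with \<open>X\<close> cost a multiple of \<open>k * L\<close> per column and stored number; the
    width of the correction supplies the second factor \<open>k\<close>.\<close>
  have "?e \<le> 4 * \<kappa> * real k * (c2 * L)"
    using const_bounds q' by (intro mult_left_mono) auto
  moreover have "\<kappa> * 1 \<le> \<kappa> * (real k * L)"
    using const_bounds mult_mono[of 1 "real k" 1 L] by (intro mult_left_mono) auto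
  ultimately have eb: "\<kappa> + ?e \<le> \<kappa> * (1 + 4 * c2) * (real k * L)"
    by (simp add: algebra_simps)
  have kL1: "1 \<le> real k * L"
    using const_bounds mult_mono[of 1 "real k" 1 L] by simp
  have "real (tmult_cost ?X 1 + mult_cost ?X 1 + nrows ?X + add_cost ?X 1)
      \<le> real (storage C) * (6 * (\<kappa> + ?e) + 2)"
    using mult_cost_le_storage[OF same const_bounds(3) e0]
      tmult_cost_le_storage[OF same const_bounds(3) e0] add_cost_le_storage[OF same]
    by (simp add: algebra_simps del: mult_cost.simps tmult_cost.simps add_cost.simps mat_of.simps)
  also have "\<dots> \<le> real (storage C) * ((6 * \<kappa> * (1 + 4 * c2) + 2) * (real k * L))"
    using eb kL1 by (intro mult_left_mono) (auto simp: algebra_simps)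
  finally have "4 * \<kappa> * real k * real (tmult_cost ?X 1 + mult_cost ?X 1 + nrows ?X + add_cost ?X 1)
      \<le> 4 * \<kappa> * real k * (real (storage C) * ((6 * \<kappa> * (1 + 4 * c2) + 2) * (real k * L)))"
    using const_bounds by (intro mult_left_mono) auto
  also have "\<dots> = real (storage C) * (level_const * (real k)\<^sup>2 * L)"
    by (simp add: level_const_def power2_eq_square)
  finally have t1: "real t \<le> real (storage C) * (level_const * (real k)\<^sup>2 * L)
      + 5 * \<kappa> * E * real (nrows A + nrows B)"
    using D(5) by linarith
  define G where "G = 5 * \<kappa> * E"
  define P where "P = ?P"
  define R where "R = level_const * (real k)\<^sup>2 * L"
  have split: "nrows A = nrows A11 + nrows A22" "nrows B = nrows B11 + nrows B22"
    "storage C = storage C11 + storage C12 + storage C21 + storage C22"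
    using step(1-3) by simp_all
  have "real t11 + G * real (nrows A11 + nrows B11) \<le> real (storage C11) * P"
    "real t12 + G * real (nrows A11 + nrows B22) \<le> real (storage C12) * P"
    "real t21 + G * real (nrows A22 + nrows B11) \<le> real (storage C21) * P"
    "real t22 + G * real (nrows A22 + nrows B22) \<le> real (storage C22) * P"
    using IH unfolding G_def[symmetric] P_def[symmetric] dims by blast+
  moreover have "real t \<le> real (storage C) * R + G * real (nrows A + nrows B)"
    using t1 unfolding G_def R_def .
  ultimately have "real (t11 + t12 + t21 + t22 + t) + G * real (nrows A + nrows B)
      \<le> real (storage C) * (P + R)"
    unfolding split by (simp add: algebra_simps)
  also have "P + R = dense_const * (real m + E) + 17 * \<kappa> * E + level_const * (real k)\<^sup>2 * L * real q"
    by (simp add: P_def R_def A(1) algebra_simps)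
  finally show ?case
    using sameX step.prems(3,4) unfolding G_def by simp
qed

text \<open>The surplus is dropped, and \<open>q \<le> c2 * L\<close> turns the sum over the levels
  into a multiple of \<open>E\<close>.\<close>

lemma dc_sylv_cost:
  assumes "dc_sylv LR DS A B C X t" "hodlr q A" "hodlr q B"
    and "nrows C = nrows A" "ncols C = nrows B" "nonempty_factors C" "nrows A \<le> n" "nrows B \<le> n"
    and "real q \<le> c2 * L"
  shows "real t \<le> (dense_const + 17 * \<kappa> + level_const * c2) * (real (storage C) * (real m + E))"
proof -
  have lev0: "0 \<le> level_const"
    using const_bounds by (simp add: level_const_def)
  have "level_const * (real k)\<^sup>2 * L * real q \<le> level_const * (real k)\<^sup>2 * L * (c2 * L)"
    using assms(9) const_bounds lev0 by (intro mult_left_mono) auto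
  moreover have "0 \<le> (17 * \<kappa> + level_const * c2) * real m"
    using const_bounds lev0 by simp
  ultimately have "dense_const * (real m + E) + 17 * \<kappa> * E + level_const * (real k)\<^sup>2 * L * real q
      \<le> (dense_const + 17 * \<kappa> + level_const * c2) * (real m + E)"
    by (simp add: algebra_simps power2_eq_square)
  then have "real (storage C) * (dense_const * (real m + E) + 17 * \<kappa> * E + level_const * (real k)\<^sup>2 * L * real q)
      \<le> real (storage C) * ((dense_const + 17 * \<kappa> + level_const * c2) * (real m + E))"
    by (rule mult_left_mono) simp
  moreover have "0 \<le> 5 * \<kappa> * E * real (nrows C + ncols C)"
    using const_bounds by simp
  ultimately show ?thesis
    using dc_sylv_levels[OF assms] by (simp add: algebra_simps)
qed

end


section \<open>Choice of the constants\<close>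

text \<open>The constants are obtained before \<open>n\<close> and \<open>k\<close> are chosen,
  which makes the final bound uniform.\<close>

lemma sylvester_runI:
  fixes LR :: lr_solver and DS :: dense_solver and c c2 :: real
  assumes "low_rank_rhs_solver LR" and "assumption1 LR" and "cubic_dense_solver DS"
    and "1 \<le> c" and "0 \<le> c2"
  obtains \<kappa> \<kappa>d where "\<And>n k. 2 \<le> n \<Longrightarrow> 1 \<le> k \<Longrightarrow> sylvester_run LR DS c c2 \<kappa> \<kappa>d (log 2 (real n)) n k"
proof -
  obtain K where K: "1 \<le> k \<Longrightarrow> stored_hodlr k A \<Longrightarrow> stored_hodlr k B \<Longrightarrow>
      factors_shape (nrows A) (nrows B) F \<Longrightarrow> LR A B F X t \<Longrightarrow>
      real t \<le> K * (real (width F) * real k * real (max (nrows A) (nrows B)) * lg (max (nrows A) (nrows B))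
        + (real k)\<^sup>2 * real (max (nrows A) (nrows B)) * (lg (max (nrows A) (nrows B)))\<^sup>2)
      \<and> real (width X) \<le> K * real (width F)" for k A B F X t
    using assms(2) unfolding assumption1_def Let_def by blast
  obtain Kd where Kd: "DS A B C X t \<Longrightarrow> square_mat A \<Longrightarrow> square_mat B \<Longrightarrow>
      C \<in> carrier_mat (dim_row A) (dim_row B) \<Longrightarrow>
      solves_sylvester A B C X \<and> real t \<le> Kd * real (max (dim_row A) (dim_row B)) ^ 3" for A B C X t
    using that assms(3) unfolding cubic_dense_solver_def by metis
  \<comment> \<open>The given constants may be negative; enlarging them keeps the bounds valid and
    provides the signs needed for monotonicity.\<close>
  define \<kappa> where "\<kappa> = max 1 K"
  define \<kappa>d where "\<kappa>d = max 0 Kd"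
  have "sylvester_run LR DS c c2 \<kappa> \<kappa>d (log 2 (real n)) n k" if n: "2 \<le> n" and k: "1 \<le> k" for n k
  proof
    have L1: "1 \<le> log 2 (real n)"
      using n by simp
    then show "1 \<le> c" "0 \<le> c2" "1 \<le> \<kappa>" "0 \<le> \<kappa>d" "1 \<le> log 2 (real n)" "1 \<le> k"
      "low_rank_rhs_solver LR"
      using assms k by (simp_all add: \<kappa>_def \<kappa>d_def)
    fix A B F X t
    assume run: "stored_hodlr k A" "stored_hodlr k B" "factors_shape (nrows A) (nrows B) F" "LR A B F X t"
      and le: "nrows A \<le> n" "nrows B \<le> n"
    let ?s = "max (nrows A) (nrows B)"
    \<comment> \<open>As \<open>n\<close> is at least 2, the lower bound 1 built into
      \<open>lg\<close> is below \<open>log 2 n\<close>. For size 0 the convention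
      \<open>log 2 0 = 0\<close> gives \<open>lg 0 = 1\<close>.\<close>
    have "lg ?s \<le> log 2 (real n)"
    proof (cases "?s = 0")
      case False
      then show ?thesis using L1 le by (auto simp: lg_def simp del: max_def)
    qed (use L1 in \<open>simp add: lg_def log_def\<close>)
    moreover have "1 \<le> lg ?s"
      by (simp add: lg_def)
    ultimately have "real (width F) * real k * real ?s * lg ?s + (real k)\<^sup>2 * real ?s * (lg ?s)\<^sup>2
      \<le> real (width F) * real k * real (nrows A + nrows B) * log 2 (real n)
        + (real k)\<^sup>2 * real (nrows A + nrows B) * (log 2 (real n))\<^sup>2"
      by (intro add_mono mult_mono power_mono) auto
    moreover have "0 \<le> real (width F) * real k * real ?s * lg ?s + (real k)\<^sup>2 * real ?s * (lg ?s)\<^sup>2"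
      using \<open>1 \<le> lg ?s\<close> by (intro add_nonneg_nonneg mult_nonneg_nonneg) auto
    ultimately have "K * (real (width F) * real k * real ?s * lg ?s + (real k)\<^sup>2 * real ?s * (lg ?s)\<^sup>2)
      \<le> \<kappa> * (real (width F) * real k * real (nrows A + nrows B) * log 2 (real n)
        + (real k)\<^sup>2 * real (nrows A + nrows B) * (log 2 (real n))\<^sup>2)"
      by (intro mult_mono) (auto simp: \<kappa>_def)
    moreover have "K * real (width F) \<le> \<kappa> * real (width F)"
      by (intro mult_right_mono) (auto simp: \<kappa>_def)
    ultimately show "real t \<le> \<kappa> * (real (width F) * real k * real (nrows A + nrows B) * log 2 (real n)
        + (real k)\<^sup>2 * real (nrows A + nrows B) * (log 2 (real n))\<^sup>2)
      \<and> real (width X) \<le> \<kappa> * real (width F)"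
      using K[OF k run] by linarith
  next
    fix A B C X t
    assume run: "DS A B C X t" "square_mat A" "square_mat B" "C \<in> carrier_mat (dim_row A) (dim_row B)"
    have "Kd * real (max (dim_row A) (dim_row B)) ^ 3 \<le> \<kappa>d * real (max (dim_row A) (dim_row B)) ^ 3"
      by (intro mult_right_mono) (auto simp: \<kappa>d_def)
    then show "X \<in> carrier_mat (dim_row A) (dim_row B) \<and>
        real t \<le> \<kappa>d * real (max (dim_row A) (dim_row B)) ^ 3"
      using Kd[OF run] unfolding solves_sylvester_def by auto
  qed
  then show thesis by (rule that)
qed

section \<open>The bound with one constant for all instances\<close>

theorem lemma2p15:
  fixes LR :: lr_solver and DS :: dense_solver and c c1 c2 :: real
  assumes "low_rank_rhs_solver LR" and "assumption1 LR" and "cubic_dense_solver DS"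
    and "1 \<le> c" and "0 < c1" and "0 < c2"
  shows "\<exists>K::real. \<forall>(n::nat) (p::nat) (nmin::nat) (k::nat) (kC::nat) TH T A B C HA HB HC X t.
     A \<in> carrier_mat n n \<and> B \<in> carrier_mat n n \<and> C \<in> carrier_mat n n \<and>
     1 \<le> k \<and>
     cluster_for n n TH \<and> hodlr_cluster p TH \<and> minimal_block_size c nmin TH \<and>
     halr TH k A \<and> halr TH k B \<and>
     cluster_for n n T \<and> compatible T TH \<and> depth T \<le> p \<and> halr T kC C \<and>
     c1 * log 2 (real n) \<le> real p \<and> real p \<le> c2 * log 2 (real n) \<and>
     stores TH A HA \<and> stores TH B HB \<and> stores T C HC \<and>
     dc_sylv LR DS HA HB HC X t \<longrightarrow>
     real t \<le> K * (real (storage HC) * (real nmin + (real k)\<^sup>2 * (log 2 (real n))\<^sup>2))"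
proof -
  obtain \<kappa> \<kappa>d where
    run: "\<And>n k. 2 \<le> n \<Longrightarrow> 1 \<le> k \<Longrightarrow> sylvester_run LR DS c c2 \<kappa> \<kappa>d (log 2 (real n)) n k"
    using sylvester_runI[OF assms(1-4) less_imp_le[OF assms(6)]] by blast
  \<comment> \<open>Built from \<open>c\<close>, \<open>c2\<close> and the constants of the solvers,
    hence independent of sizes, ranks and clusters.\<close>
  let ?K = "sylvester_run.dense_const c c2 \<kappa> \<kappa>d + 17 * \<kappa> + sylvester_run.level_const c2 \<kappa> * c2"
  show ?thesis
  proof (intro exI[of _ ?K] allI impI, elim conjE)
    fix n p nmin k kC :: nat and TH T A B C HA HB HC X t
    assume k: "1 \<le> k" and TH: "cluster_for n n TH" "hodlr_cluster p TH" "minimal_block_size c nmin TH"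
      and halr: "halr TH k A" "halr TH k B" and T: "cluster_for n n T"
      and p: "real p \<le> c2 * log 2 (real n)"
      and st: "stores TH A HA" "stores TH B HB" "stores T C HC" and dc: "dc_sylv LR DS HA HB HC X t"
    have p1: "1 \<le> p"
      using TH(2) by (cases TH) auto
    \<comment> \<open>The upper bound on \<open>p\<close> with \<open>1 \<le> p\<close> excludes
      \<open>log 2 n = 0\<close>, which is the value at 1 and, by convention, at 0.\<close>
    have n: "2 \<le> n"
    proof (rule ccontr)
      assume "\<not> 2 \<le> n"
      then have "n = 0 \<or> n = 1" by linarith
      then have "log 2 (real n) = 0" by (auto simp: log_def)
      with p p1 show False by simp
    qed
    interpret sylvester_run LR DS c c2 \<kappa> \<kappa>d "log 2 (real n)" n nmin k
      by (rule run[OF n k])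
    \<comment> \<open>Depth \<open>p\<close> means \<open>p - 1\<close> levels below the
      root.\<close>
    have hod: "hodlr (p - 1) HA" "hodlr (p - 1) HB"
      using TH halr st p1 unfolding hodlr_stored_def cluster_for_def by auto
    have dims: "nrows HA = n" "nrows HB = n" "nrows HC = n" "ncols HC = n"
      using TH(1) T st dims_stores by (auto simp: cluster_for_def ilen_def)
    show "real t \<le> ?K * (real (storage HC) * (real nmin + (real k)\<^sup>2 * (log 2 (real n))\<^sup>2))"
      using dc_sylv_cost[OF dc hod] dims stores_nonempty_factors[OF st(3)] p p1 by simp
  qed
qed

end
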